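(* Let $L$ be a complex Leibniz algebra whose corresponding Lie algebra $L/I$ is isomorphic to the complex Diamond Lie algebra $\mathfrak{D}_{\mathbb{C}}$ and whose ideal $I$, as a right $\mathfrak{D}_{\mathbb{C}}$-module, is the module with basis $\{X_1,X_2,X_3\}$ and action (omitted products are zero) $$\begin{array}{lll} (X_1,J)=\frac{i}{3}X_1, & (X_2,J)=-\frac{2i}{3}X_2, & (X_3,J)=\frac{i}{3}X_3,\\ (X_1,P_+)=X_2, & (X_2,P_-)=X_3, & (X_1,T)=-\frac{i}{2}X_3. \end{array}$$ Then $L$ admits a basis $\{J,P_+,P_-,T,X_1,X_2,X_3\}$ in which its table of multiplication is (omitted products are zero) $$L_2:\quad\begin{array}{lll} [J,P_+]=iP_+, & [J,P_-]=-iP_-, & [P_+,P_-]=2iT,\\ [P_+,J]=-iP_+, & [P_-,J]=iP_-, & [P_-,P_+]=-2iT,\\ [X_1,J]=\frac{1}{3}iX_1, & [X_2,J]=-\frac{2}{3}iX_2, & [X_3,J]=\frac{1}{3}iX_3,\\ [X_1,P_+]=X_2, & [X_2,P_-]=X_3, & [X_1,T]=-\frac{i}{2}X_3. \end{array}$$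
   Context: A Leibniz algebra over a field is a vector space $L$ with a bilinear product $[-,-]$ satisfying $[x,[y,z]]=[[x,y],z]-[[x,z],y]$ for all $x,y,z\in L$. For a Leibniz algebra $L$, $I$ denotes the ideal generated by the squares $[x,x]$, $x\in L$; it is contained in the right annihilator of $L$ (i.e. $[y,a]=0$ for all $y\in L$, $a\in I$). The quotient $\overline{L}=L/I$ is a Lie algebra, called the corresponding Lie algebra of $L$, and $I$ is a right $\overline{L}$-module via $(a,\overline{x})\mapsto[a,x]$. Right modules over a Lie algebra satisfy $(m,[x,y])=((m,x),y)-((m,y),x)$. The complex Diamond Lie algebra $\mathfrak{D}_{\mathbb{C}}$ is the four-dimensional complex Lie algebra with basis $\{J,P_+,P_-,T\}$ and nonzero brackets (up to antisymmetry) $[J,P_+]=iP_+$, $[J,P_-]=-iP_-$, $[P_+,P_-]=2iT$, where $i$ is the imaginary unit. *)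

theory Defs
  imports "HOL-Analysis.Analysis"
begin

definition (in vector_space) indexed_basis :: "('i \<Rightarrow> 'b) \<Rightarrow> bool" where
  "indexed_basis e \<longleftrightarrow> inj e \<and> independent (range e) \<and> span (range e) = UNIV"

locale leibniz_algebra = vector_space scale
  for scale :: "'k::field \<Rightarrow> 'a::ab_group_add \<Rightarrow> 'a" +
  fixes bracket :: "'a \<Rightarrow> 'a \<Rightarrow> 'a"
  assumes linear_bracket_left: "Vector_Spaces.linear scale scale (\<lambda>x. bracket x y)"
    and linear_bracket_right: "Vector_Spaces.linear scale scale (\<lambda>y. bracket x y)"
    and leibniz: "bracket x (bracket y z) = bracket (bracket x y) z - bracket (bracket x z) y"
begin

lemma bracket_simps:
  "bracket (x + y) z = bracket x z + bracket y z"
  "bracket x (y + z) = bracket x y + bracket x z"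
  "bracket (scale c x) z = scale c (bracket x z)"
  "bracket x (scale c z) = scale c (bracket x z)"
  "bracket (x - y) z = bracket x z - bracket y z"
  "bracket x (y - z) = bracket x y - bracket x z"
  "bracket 0 z = 0"
  "bracket x 0 = 0"
proof -
  interpret l: Vector_Spaces.linear scale scale "\<lambda>x. bracket x z" for z
    by (rule linear_bracket_left)
  interpret r: Vector_Spaces.linear scale scale "\<lambda>z. bracket x z" for x
    by (rule linear_bracket_right)
  show
    "bracket (x + y) z = bracket x z + bracket y z"
    "bracket x (y + z) = bracket x y + bracket x z"
    "bracket (scale c x) z = scale c (bracket x z)"
    "bracket x (scale c z) = scale c (bracket x z)"
    "bracket (x - y) z = bracket x z - bracket y z"
    "bracket x (y - z) = bracket x y - bracket x z"
    "bracket 0 z = 0"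
    "bracket x 0 = 0"
    by (fact l.add r.add l.scale r.scale l.diff r.diff l.zero r.zero)+
qed

definition leibniz_ideal :: "'a set \<Rightarrow> bool" where
  "leibniz_ideal S \<longleftrightarrow>
     subspace S \<and> (\<forall>a\<in>S. \<forall>x. bracket a x \<in> S \<and> bracket x a \<in> S)"

definition squares_ideal :: "'a set" where
  "squares_ideal = leibniz_ideal hull (range (\<lambda>x. bracket x x))"

lemma leibniz_ideal_squares_ideal: "leibniz_ideal squares_ideal"
  unfolding squares_ideal_def
  by (rule hull_in) (auto simp: leibniz_ideal_def subspace_def)

lemma bracket_square_mem: "bracket x x \<in> squares_ideal"
  unfolding squares_ideal_def by (auto intro: hull_inc)

lemma squares_ideal_right_annihilator:
  assumes "a \<in> squares_ideal"
  shows "bracket y a = 0"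
proof -
  have "leibniz_ideal {a. \<forall>y. bracket y a = 0}"
    by (auto simp: leibniz_ideal_def subspace_def bracket_simps leibniz)
  moreover have "range (\<lambda>x. bracket x x) \<subseteq> {a. \<forall>y. bracket y a = 0}"
    by (auto simp: leibniz)
  ultimately have "squares_ideal \<subseteq> {a. \<forall>y. bracket y a = 0}"
    unfolding squares_ideal_def by (intro hull_minimal)
  with assms show ?thesis by blast
qed

text \<open>The quotient by \<open>squares_ideal\<close> is realised on the set of cosets. The operations
  are given by unions over all representatives; on cosets they are computed by
  \<open>corr_coset_simps\<close> below.\<close>

definition corr_coset :: "'a \<Rightarrow> 'a set" where
  "corr_coset x = {x + a | a. a \<in> squares_ideal}"

definition corr_carrier :: "'a set set" where
  "corr_carrier = range corr_coset"

definition corr_add :: "'a set \<Rightarrow> 'a set \<Rightarrow> 'a set" where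
  "corr_add A B = (\<Union>x\<in>A. \<Union>y\<in>B. corr_coset (x + y))"

definition corr_scale :: "'k \<Rightarrow> 'a set \<Rightarrow> 'a set" where
  "corr_scale c A = (\<Union>x\<in>A. corr_coset (scale c x))"

definition corr_bracket :: "'a set \<Rightarrow> 'a set \<Rightarrow> 'a set" where
  "corr_bracket A B = (\<Union>x\<in>A. \<Union>y\<in>B. corr_coset (bracket x y))"

definition corr_action :: "'a \<Rightarrow> 'a set \<Rightarrow> 'a" where
  "corr_action a A = (THE b. \<exists>x\<in>A. b = bracket a x)"

lemma corr_coset_eq_iff: "corr_coset x = corr_coset y \<longleftrightarrow> x - y \<in> squares_ideal"
proof -
  have sub: "subspace squares_ideal"
    using leibniz_ideal_squares_ideal by (simp add: leibniz_ideal_def)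
  show ?thesis
  proof
    assume "corr_coset x = corr_coset y"
    moreover have "x \<in> corr_coset x"
      using subspace_0[OF sub] by (force simp: corr_coset_def)
    ultimately show "x - y \<in> squares_ideal" by (auto simp: corr_coset_def)
  next
    have *: "corr_coset x \<subseteq> corr_coset y" if "x - y \<in> squares_ideal" for x y
    proof
      fix z assume "z \<in> corr_coset x"
      then obtain a where a: "a \<in> squares_ideal" "z = x + a" by (auto simp: corr_coset_def)
      then have "z = y + ((x - y) + a)" by simp
      with subspace_add[OF sub that a(1)] show "z \<in> corr_coset y"
        unfolding corr_coset_def by blast
    qed
    assume xy: "x - y \<in> squares_ideal"
    then have "y - x \<in> squares_ideal" using subspace_neg[OF sub xy] by simp
    with xy * show "corr_coset x = corr_coset y" by (simp add: subset_antisym)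
  qed
qed

lemma corr_coset_simps:
  "corr_add (corr_coset x) (corr_coset y) = corr_coset (x + y)"
  "corr_scale c (corr_coset x) = corr_coset (scale c x)"
  "corr_bracket (corr_coset x) (corr_coset y) = corr_coset (bracket x y)"
  "corr_action a (corr_coset x) = bracket a x"
proof -
  have I: "leibniz_ideal squares_ideal" by (rule leibniz_ideal_squares_ideal)
  then have sub: "subspace squares_ideal" by (simp add: leibniz_ideal_def)
  have mem: "x' \<in> corr_coset x \<longleftrightarrow> x' - x \<in> squares_ideal" for x x'
    by (auto simp: corr_coset_def intro: exI[of _ "x' - x"])
  have self: "x \<in> corr_coset x" for x using subspace_0[OF sub] by (simp add: mem)
  have "corr_coset (x' + y') = corr_coset (x + y)"
    if "x' \<in> corr_coset x" "y' \<in> corr_coset y" for x' y'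
    using subspace_add[OF sub that[unfolded mem]] by (simp add: corr_coset_eq_iff algebra_simps)
  with self show "corr_add (corr_coset x) (corr_coset y) = corr_coset (x + y)"
    unfolding corr_add_def by blast
  have "corr_coset (scale c x') = corr_coset (scale c x)" if "x' \<in> corr_coset x" for x'
    using subspace_scale[OF sub that[unfolded mem]]
    by (simp add: corr_coset_eq_iff scale_right_diff_distrib)
  with self show "corr_scale c (corr_coset x) = corr_coset (scale c x)"
    unfolding corr_scale_def by blast
  have "corr_coset (bracket x' y') = corr_coset (bracket x y)"
    if "x' \<in> corr_coset x" "y' \<in> corr_coset y" for x' y'
  proof -
    have "bracket (x' - x) y' \<in> squares_ideal" "bracket x (y' - y) \<in> squares_ideal"
      using that I by (auto simp: mem leibniz_ideal_def)
    from subspace_add[OF sub this] show ?thesis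
      by (simp add: corr_coset_eq_iff bracket_simps)
  qed
  with self show "corr_bracket (corr_coset x) (corr_coset y) = corr_coset (bracket x y)"
    unfolding corr_bracket_def by blast
  have "bracket a x' = bracket a x" if "x' \<in> corr_coset x" for x'
    using squares_ideal_right_annihilator[OF that[unfolded mem], of a]
    by (simp add: bracket_simps)
  with self show "corr_action a (corr_coset x) = bracket a x"
    unfolding corr_action_def by (intro the_equality) blast+
qed

definition corr_iso ::
  "('k \<Rightarrow> 'g::ab_group_add \<Rightarrow> 'g) \<Rightarrow> ('g \<Rightarrow> 'g \<Rightarrow> 'g) \<Rightarrow> ('a set \<Rightarrow> 'g) \<Rightarrow> bool" where
  "corr_iso scaleg bracketg \<Phi> \<longleftrightarrow>
     bij_betw \<Phi> corr_carrier UNIV \<and>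
     (\<forall>A\<in>corr_carrier. \<forall>B\<in>corr_carrier. \<Phi> (corr_add A B) = \<Phi> A + \<Phi> B) \<and>
     (\<forall>c. \<forall>A\<in>corr_carrier. \<Phi> (corr_scale c A) = scaleg c (\<Phi> A)) \<and>
     (\<forall>A\<in>corr_carrier. \<forall>B\<in>corr_carrier. \<Phi> (corr_bracket A B) = bracketg (\<Phi> A) (\<Phi> B))"

text \<open>\<open>squares_ideal_iso scalem act \<Phi> \<Psi>\<close>: if \<open>\<Phi>\<close> identifies the corresponding Lie algebra
  with a Lie algebra \<open>'g\<close>, then \<open>\<Psi>\<close> is an isomorphism of right \<open>'g\<close>-modules from
  \<open>squares_ideal\<close> onto \<open>'m\<close> with action \<open>act\<close>.\<close>

definition squares_ideal_iso ::
  "('k \<Rightarrow> 'm::ab_group_add \<Rightarrow> 'm) \<Rightarrow> ('m \<Rightarrow> 'g \<Rightarrow> 'm) \<Rightarrow>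
    ('a set \<Rightarrow> 'g) \<Rightarrow> ('a \<Rightarrow> 'm) \<Rightarrow> bool" where
  "squares_ideal_iso scalem act \<Phi> \<Psi> \<longleftrightarrow>
     bij_betw \<Psi> squares_ideal UNIV \<and>
     (\<forall>a\<in>squares_ideal. \<forall>b\<in>squares_ideal. \<Psi> (a + b) = \<Psi> a + \<Psi> b) \<and>
     (\<forall>c. \<forall>a\<in>squares_ideal. \<Psi> (scale c a) = scalem c (\<Psi> a)) \<and>
     (\<forall>a\<in>squares_ideal. \<forall>A\<in>corr_carrier. \<Psi> (corr_action a A) = act (\<Psi> a) (\<Phi> A))"

end

datatype diamond_gen = J | P_plus | P_minus | T

lemma UNIV_diamond_gen: "UNIV = {J, P_plus, P_minus, T}"
  by (auto intro: diamond_gen.exhaust)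

instance diamond_gen :: finite
  by standard (simp add: UNIV_diamond_gen)

fun diamond_table :: "diamond_gen \<Rightarrow> diamond_gen \<Rightarrow> complex ^ diamond_gen" where
  "diamond_table J P_plus = \<i> *s axis P_plus 1"
| "diamond_table P_plus J = - \<i> *s axis P_plus 1"
| "diamond_table J P_minus = - \<i> *s axis P_minus 1"
| "diamond_table P_minus J = \<i> *s axis P_minus 1"
| "diamond_table P_plus P_minus = (2 * \<i>) *s axis T 1"
| "diamond_table P_minus P_plus = - (2 * \<i>) *s axis T 1"
| "diamond_table _ _ = 0"

definition diamond_bracket ::
  "complex ^ diamond_gen \<Rightarrow> complex ^ diamond_gen \<Rightarrow> complex ^ diamond_gen" where
  "diamond_bracket x y = (\<Sum>p\<in>UNIV. \<Sum>q\<in>UNIV. (x $ p * y $ q) *s diamond_table p q)"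

datatype module_gen = X1 | X2 | X3

lemma UNIV_module_gen: "UNIV = {X1, X2, X3}"
  by (auto intro: module_gen.exhaust)

instance module_gen :: finite
  by standard (simp add: UNIV_module_gen)

fun module_table :: "module_gen \<Rightarrow> diamond_gen \<Rightarrow> complex ^ module_gen" where
  "module_table X1 J = (\<i> / 3) *s axis X1 1"
| "module_table X2 J = - (2 * \<i> / 3) *s axis X2 1"
| "module_table X3 J = (\<i> / 3) *s axis X3 1"
| "module_table X1 P_plus = axis X2 1"
| "module_table X2 P_minus = axis X3 1"
| "module_table X1 T = - (\<i> / 2) *s axis X3 1"
| "module_table _ _ = 0"

definition module_action ::
  "complex ^ module_gen \<Rightarrow> complex ^ diamond_gen \<Rightarrow> complex ^ module_gen" where
  "module_action m x = (\<Sum>p\<in>UNIV. \<Sum>q\<in>UNIV. (m $ p * x $ q) *s module_table p q)"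

lemma diamond_bracket_alternating: "diamond_bracket x x = 0"
  by (simp add: diamond_bracket_def UNIV_diamond_gen vec_eq_iff axis_def)

lemma leibniz_algebra_diamond: "leibniz_algebra (*s) diamond_bracket"
proof
  show "diamond_bracket x (diamond_bracket y z) =
      diamond_bracket (diamond_bracket x y) z - diamond_bracket (diamond_bracket x z) y" for x y z
    by (simp add: diamond_bracket_def UNIV_diamond_gen vec_eq_iff axis_def)
      (auto simp: algebra_simps)
qed (simp_all add: diamond_bracket_def UNIV_diamond_gen vec_eq_iff axis_def algebra_simps)

lemma module_action_bracket:
  "module_action m (diamond_bracket x y) =
     module_action (module_action m x) y - module_action (module_action m y) x"
  by (simp add: module_action_def diamond_bracket_def UNIV_diamond_gen UNIV_module_gen
      vec_eq_iff axis_def) (auto simp: field_simps)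

text \<open>\<open>L2_table sc e p q\<close> is the product of the basis vectors \<open>e p\<close> and \<open>e q\<close>;
  \<open>Inl\<close> tags the generators \<open>J, P_plus, P_minus, T\<close> and \<open>Inr\<close> the generators \<open>X1, X2, X3\<close>.\<close>

fun L2_table ::
  "(complex \<Rightarrow> 'a::ab_group_add \<Rightarrow> 'a) \<Rightarrow> (diamond_gen + module_gen \<Rightarrow> 'a) \<Rightarrow>
    diamond_gen + module_gen \<Rightarrow> diamond_gen + module_gen \<Rightarrow> 'a" where
  "L2_table sc e (Inl J) (Inl P_plus) = sc \<i> (e (Inl P_plus))"
| "L2_table sc e (Inl J) (Inl P_minus) = sc (- \<i>) (e (Inl P_minus))"
| "L2_table sc e (Inl P_plus) (Inl P_minus) = sc (2 * \<i>) (e (Inl T))"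
| "L2_table sc e (Inl P_plus) (Inl J) = sc (- \<i>) (e (Inl P_plus))"
| "L2_table sc e (Inl P_minus) (Inl J) = sc \<i> (e (Inl P_minus))"
| "L2_table sc e (Inl P_minus) (Inl P_plus) = sc (- (2 * \<i>)) (e (Inl T))"
| "L2_table sc e (Inr X1) (Inl J) = sc (1 / 3 * \<i>) (e (Inr X1))"
| "L2_table sc e (Inr X2) (Inl J) = sc (- (2 / 3) * \<i>) (e (Inr X2))"
| "L2_table sc e (Inr X3) (Inl J) = sc (1 / 3 * \<i>) (e (Inr X3))"
| "L2_table sc e (Inr X1) (Inl P_plus) = e (Inr X2)"
| "L2_table sc e (Inr X2) (Inl P_minus) = e (Inr X3)"
| "L2_table sc e (Inr X1) (Inl T) = sc (- (\<i> / 2)) (e (Inr X3))"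
| "L2_table sc e _ _ = 0"

end

theory Submission
  imports Defs
begin

text \<open>
  After correcting a lift of \<open>J\<close> by an element of the ideal \<open>I\<close> one has \<open>[J, J] = 0\<close>; then the
  derivation \<open>x \<mapsto> [x, J]\<close> is diagonalisable with weights \<open>\<i>/3, -2\<i>/3, \<i>/3\<close> on \<open>I\<close> and weights
  \<open>0, -\<i>, \<i>, 0\<close> on the quotient. Since these two sets are disjoint, every generator lifts to a
  weight vector. The defect of a product of two lifted generators lies in \<open>I\<close> but has a
  weight in \<open>\<int>\<i>\<close>, hence vanishes, so the extension splits.
\<close>

section \<open>Coordinates and finite indexed bases\<close>

lemma (in vector_space) indexed_basisI:
  fixes e :: "'i::finite \<Rightarrow> 'b"
  assumes lin_indep: "\<And>u i. (\<Sum>j\<in>UNIV. u j *s e j) = 0 \<Longrightarrow> u i = 0"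
    and spanning: "\<And>x. \<exists>u. x = (\<Sum>j\<in>UNIV. u j *s e j)"
  shows "indexed_basis e"
proof -
  have inj: "inj e"
  proof (rule injI, rule ccontr)
    fix i k assume eq: "e i = e k" and ne: "i \<noteq> k"
    \<comment> \<open>If \<open>e i = e k\<close>, coefficients 1 at \<open>i\<close> and -1 at
      \<open>k\<close> give a nontrivial relation, so injectivity follows from
      \<open>lin_indep\<close>.\<close>
    let ?u = "\<lambda>j. (if j = i then 1 else 0) - (if j = k then 1 else 0) :: 'a"
    have "(\<Sum>j\<in>UNIV. ?u j *s e j) =
        (\<Sum>j\<in>UNIV. (if j = i then e j else 0) - (if j = k then e j else 0))"
      by (rule sum.cong) (auto simp: scale_left_diff_distrib)
    also have "\<dots> = 0"
      by (simp add: sum_subtractf eq)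
    finally have "?u i = 0" by (rule lin_indep)
    with ne show False by simp
  qed
  have "independent (range e)"
  proof
    assume "dependent (range e)"
    then obtain u i where "u (e i) \<noteq> 0" "(\<Sum>v\<in>range e. u v *s v) = 0"
      by (auto simp: dependent_finite)
    then show False
      using lin_indep[of "\<lambda>j. u (e j)" i] by (simp add: sum.reindex[OF inj])
  qed
  moreover have "x \<in> span (range e)" for x
  proof -
    obtain u where "x = (\<Sum>j\<in>UNIV. u j *s e j)"
      using spanning by blast
    also have "\<dots> \<in> span (range e)"
      by (intro span_sum span_scale span_base rangeI)
    finally show ?thesis .
  qed
  ultimately show ?thesis
    unfolding indexed_basis_def using inj by auto
qed

lemma sum_sum_type:
  fixes f :: "'i::finite + 'j::finite \<Rightarrow> 'c::comm_monoid_add"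
  shows "(\<Sum>j\<in>UNIV. f j) = (\<Sum>p\<in>UNIV. f (Inl p)) + (\<Sum>m\<in>UNIV. f (Inr m))"
  by (simp add: UNIV_Plus_UNIV[symmetric] sum.Plus del: UNIV_Plus_UNIV)

lemma vec_eq_sum_axis: "v = (\<Sum>i\<in>UNIV. (v $ i) *s axis i (1::'k::semiring_1))"
  by (simp add: vec_eq_iff axis_def if_distrib[of "(*) _"] cong: if_cong)

section \<open>Structure constants and weights of \<open>J\<close>\<close>

lemma diamond_bracket_axis: "diamond_bracket (axis p 1) (axis q 1) = diamond_table p q"
  by (cases p; cases q) (simp_all add: diamond_bracket_def UNIV_diamond_gen axis_def)

lemma module_action_axis: "module_action (axis m 1) (axis q 1) = module_table m q"
  by (cases m; cases q)
    (simp_all add: module_action_def UNIV_diamond_gen UNIV_module_gen axis_def)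

text \<open>Weights are eigenvalues of bracketing with \<open>J\<close> on the right, the side on
  which the ideal is acted on; hence the sign opposite to that in [J, P_+].\<close>

fun diamond_weight :: "diamond_gen \<Rightarrow> complex" where
  "diamond_weight J = 0"
| "diamond_weight P_plus = - \<i>"
| "diamond_weight P_minus = \<i>"
| "diamond_weight T = 0"

fun module_weight :: "module_gen \<Rightarrow> complex" where
  "module_weight X1 = \<i> / 3"
| "module_weight X2 = - (2 * \<i> / 3)"
| "module_weight X3 = \<i> / 3"

lemma diamond_bracket_J:
  "diamond_bracket (axis p 1) (axis J 1) = diamond_weight p *s axis p 1"
  by (cases p) (simp_all add: diamond_bracket_axis)

lemma module_action_J: "module_action v (axis J 1) $ m = module_weight m * v $ m"
  by (cases m)
    (simp_all add: module_action_def UNIV_diamond_gen UNIV_module_gen axis_def)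

text \<open>Integer multiples of \<i> are closed under sums, so avoiding them separates module
  weights both from single weights and from sums of two.\<close>

lemma diamond_weight_Ints: "diamond_weight p \<in> (\<lambda>k. \<i> * of_int k) ` UNIV"
proof (cases p)
  case P_plus
  then show ?thesis by (auto intro!: image_eqI[of _ _ "-1"])
next
  case P_minus
  then show ?thesis by (auto intro!: image_eqI[of _ _ "1"])
qed (auto intro!: image_eqI[of _ _ "0"])

lemma module_weight_neq: "module_weight m \<noteq> \<i> * of_int k"
proof
  assume *: "module_weight m = \<i> * of_int k"
  \<comment> \<open>Three times the imaginary part of a module weight is 1 or -2, and neither is a
    multiple of 3.\<close>
  have "3 * k = 1 \<or> 3 * k = -2"
  proof (cases m)
    case X2
    with * have "Im (- (2 * \<i> / 3)) = Im (\<i> * of_int k)" by simp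
    then have "real_of_int (3 * k) = real_of_int (-2)" by simp
    then show ?thesis by linarith
  qed (use * arg_cong[OF *, of Im] in simp_all)
  then show False by presburger
qed

lemma module_weight_neq_diamond_weight: "module_weight m \<noteq> diamond_weight p"
  using diamond_weight_Ints[of p] module_weight_neq by auto

lemma module_weight_neq_diamond_weight_add:
  "module_weight m \<noteq> diamond_weight p + diamond_weight q"
proof -
  obtain k l where "diamond_weight p = \<i> * of_int k" "diamond_weight q = \<i> * of_int l"
    using diamond_weight_Ints by blast
  then have "diamond_weight p + diamond_weight q = \<i> * of_int (k + l)"
    by (simp add: distrib_left)
  then show ?thesis using module_weight_neq by metis
qed

text \<open>The bracket is graded by weight because right bracketing with \<open>J\<close> is a
  derivation.\<close>

lemma diamond_table_weight:
  "diamond_table p q $ r \<noteq> 0 \<Longrightarrow> diamond_weight r = diamond_weight p + diamond_weight q"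
  by (cases p; cases q; cases r) (simp_all add: axis_def)

section \<open>The extension: quotient map and coordinates on the ideal\<close>

locale diamond_extension = leibniz_algebra sc bracket
  for sc :: "complex \<Rightarrow> 'a::ab_group_add \<Rightarrow> 'a" and bracket +
  fixes \<Phi> :: "'a set \<Rightarrow> complex ^ diamond_gen"
    and \<Psi> :: "'a \<Rightarrow> complex ^ module_gen"
  assumes corr_iso: "corr_iso (*s) diamond_bracket \<Phi>"
    and module_iso: "squares_ideal_iso (*s) module_action \<Phi> \<Psi>"
begin

abbreviation I where "I \<equiv> squares_ideal"

lemma subspace_I: "subspace I"
  using leibniz_ideal_squares_ideal by (simp add: leibniz_ideal_def)

lemma bracket_mem_I: "a \<in> I \<Longrightarrow> bracket a x \<in> I"
  using leibniz_ideal_squares_ideal by (simp add: leibniz_ideal_def)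

text \<open>The quotient homomorphism onto the Diamond algebra, with cosets hidden; its kernel is
  \<open>I\<close> by \<open>proj_eq_0_iff\<close>.\<close>

definition proj where "proj x = \<Phi> (corr_coset x)"

lemma proj_simps:
  "proj (x + y) = proj x + proj y"
  "proj (sc c x) = c *s proj x"
  "proj (bracket x y) = diamond_bracket (proj x) (proj y)"
  using corr_iso
  by (simp_all add: proj_def corr_iso_def corr_carrier_def flip: corr_coset_simps(1-3))

lemma proj_0: "proj 0 = 0"
  using proj_simps(2)[of 0 0] by (simp add: vec_eq_iff)

lemma proj_diff: "proj (x - y) = proj x - proj y"
  using proj_simps(1)[of "x - y" y] by (simp add: algebra_simps)

lemma proj_sum: "proj (sum f A) = (\<Sum>x\<in>A. proj (f x))"
  by (induction A rule: infinite_finite_induct) (simp_all add: proj_0 proj_simps)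

lemma proj_eq_0_iff: "proj x = 0 \<longleftrightarrow> x \<in> I"
proof -
  have "inj_on \<Phi> corr_carrier"
    using corr_iso by (simp add: corr_iso_def bij_betw_def)
  then have "proj x = proj 0 \<longleftrightarrow> corr_coset x = corr_coset 0"
    unfolding proj_def by (rule inj_on_eq_iff) (simp_all add: corr_carrier_def)
  then show ?thesis
    by (simp add: proj_0 corr_coset_eq_iff)
qed

lemma proj_surj: "\<exists>x. proj x = v"
proof -
  have "v \<in> \<Phi> ` corr_carrier"
    using corr_iso by (simp add: corr_iso_def bij_betw_def)
  then show ?thesis
    by (auto simp: proj_def corr_carrier_def)
qed

lemma \<Psi>_bij: "bij_betw \<Psi> I UNIV"
  using module_iso by (simp add: squares_ideal_iso_def)

lemma \<Psi>_simps:
  "a \<in> I \<Longrightarrow> b \<in> I \<Longrightarrow> \<Psi> (a + b) = \<Psi> a + \<Psi> b"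
  "a \<in> I \<Longrightarrow> \<Psi> (sc c a) = c *s \<Psi> a"
  using module_iso by (simp_all add: squares_ideal_iso_def)

text \<open>The action of a coset is computed by any representative, so right bracketing on
  \<open>I\<close> depends on \<open>x\<close> only through \<open>proj x\<close>.\<close>

lemma \<Psi>_bracket: "a \<in> I \<Longrightarrow> \<Psi> (bracket a x) = module_action (\<Psi> a) (proj x)"
  using module_iso
  by (simp add: squares_ideal_iso_def corr_carrier_def proj_def flip: corr_coset_simps)

lemma \<Psi>_0: "\<Psi> 0 = 0"
  using \<Psi>_simps(2)[of 0 0] subspace_0[OF subspace_I] by (simp add: vec_eq_iff)

lemma \<Psi>_sum: "(\<And>x. x \<in> A \<Longrightarrow> f x \<in> I) \<Longrightarrow> \<Psi> (sum f A) = (\<Sum>x\<in>A. \<Psi> (f x))"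
  by (induction A rule: infinite_finite_induct)
    (simp_all add: \<Psi>_0 \<Psi>_simps subspace_sum[OF subspace_I])

lemma \<Psi>_inj: "a \<in> I \<Longrightarrow> b \<in> I \<Longrightarrow> \<Psi> a = \<Psi> b \<Longrightarrow> a = b"
  using \<Psi>_bij by (auto simp: bij_betw_def inj_on_def)

lemma \<Psi>_surj: obtains a where "a \<in> I" "\<Psi> a = v"
  using \<Psi>_bij by (metis UNIV_I bij_betw_def imageE)

section \<open>Weight arguments and the splitting\<close>

lemma bracket_J_shift_surj:
  assumes j: "proj j = axis J 1" and b: "b \<in> I" and c: "\<And>m. module_weight m \<noteq> c"
  obtains a where "a \<in> I" "bracket a j - sc c a = b"
proof -
  \<comment> \<open>In \<open>\<Psi>\<close>-coordinates, right bracketing with \<open>j\<close> is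
    diagonal with entries \<open>module_weight m\<close>. Subtracting \<open>c\<close> leaves
    nonzero entries, so the inverse is coordinatewise division.\<close>
  obtain a where a: "a \<in> I" "\<Psi> a = (\<chi> m. \<Psi> b $ m / (module_weight m - c))"
    by (rule \<Psi>_surj)
  have mem: "sc c a \<in> I" "b + sc c a \<in> I" "bracket a j \<in> I"
    using a b by (simp_all add: subspace_I subspace_scale subspace_add bracket_mem_I)
  have "\<Psi> (bracket a j) = \<Psi> (b + sc c a)"
    using a b mem c
    by (simp add: \<Psi>_bracket \<Psi>_simps j vec_eq_iff module_action_J field_simps)
  then have "bracket a j = b + sc c a"
    using mem by (intro \<Psi>_inj)
  with a(1) show thesis by (intro that[of a]) (simp_all add: algebra_simps)
qed

text \<open>Injectivity counterpart of \<open>bracket_J_shift_surj\<close>: each coordinate of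
  \<open>\<Psi> a\<close> is killed by the nonzero factor
  \<open>module_weight m - c\<close>.\<close>

lemma weight_vector_in_I_eq_0:
  assumes j: "proj j = axis J 1" and a: "a \<in> I" "bracket a j = sc c a"
    and c: "\<And>m. module_weight m \<noteq> c"
  shows "a = 0"
proof -
  have "\<Psi> (bracket a j) = \<Psi> (sc c a)"
    using a by simp
  then have "\<Psi> a = 0"
    using a(1) c by (simp add: \<Psi>_bracket \<Psi>_simps j vec_eq_iff module_action_J)
  then show ?thesis
    using a(1) subspace_0[OF subspace_I] by (intro \<Psi>_inj) (simp_all add: \<Psi>_0)
qed

lemma bracket_I_right: "a \<in> I \<Longrightarrow> bracket x a = 0"
  by (rule squares_ideal_right_annihilator)

text \<open>The square of a lift \<open>y\<close> lies in \<open>I\<close> and 0 is not a module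
  weight, so [a, y] = [y, y] is solvable in \<open>I\<close>. As \<open>a\<close> on the right gives
  0, [y - a, y - a] = [y, y] - [a, y] = 0.\<close>

lemma exists_lift_J: obtains j where "proj j = axis J 1" "bracket j j = 0"
proof -
  obtain y where y: "proj y = axis J 1"
    using proj_surj by blast
  have "module_weight m \<noteq> 0" for m
    using module_weight_neq[of m 0] by simp
  then obtain a where a: "a \<in> I" "bracket a y - sc 0 a = bracket y y"
    using bracket_J_shift_surj[OF y bracket_square_mem] by metis
  show thesis
  proof
    have "proj a = 0"
      using a(1) by (simp add: proj_eq_0_iff)
    then show "proj (y - a) = axis J 1"
      by (simp add: proj_diff y)
    show "bracket (y - a) (y - a) = 0"
      using a by (simp add: bracket_simps bracket_I_right)
  qed
qed

text \<open>The weight equation holds modulo \<open>I\<close>, so the error of a lift lies in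
  \<open>I\<close>. Its weight is not a module weight, so subtracting an element of \<open>I\<close>
  removes the error and keeps the projection.\<close>

lemma exists_weight_lift:
  assumes j: "proj j = axis J 1"
  shows "\<exists>x. proj x = axis p 1 \<and> bracket x j = sc (diamond_weight p) x"
proof -
  let ?c = "diamond_weight p"
  obtain y where y: "proj y = axis p 1"
    using proj_surj by blast
  have "proj (bracket y j - sc ?c y) = 0"
    by (simp add: proj_diff proj_simps y j diamond_bracket_J)
  then have "bracket y j - sc ?c y \<in> I"
    by (simp add: proj_eq_0_iff)
  then obtain a where a: "a \<in> I" "bracket a j - sc ?c a = bracket y j - sc ?c y"
    using bracket_J_shift_surj[OF j _ module_weight_neq_diamond_weight] by blast
  then have "proj a = 0"
    by (simp add: proj_eq_0_iff)
  with a show ?thesis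
    by (intro exI[of _ "y - a"])
      (simp add: proj_diff y bracket_simps scale_right_diff_distrib algebra_simps)
qed

text \<open>Rearranged as [[x, y], j] = [x, [y, j]] + [[x, j], y], the Leibniz identity makes right
  bracketing with \<open>j\<close> a derivation, so weights add.\<close>

lemma weight_bracket:
  assumes "bracket x j = sc c x" "bracket y j = sc d y"
  shows "bracket (bracket x y) j = sc (c + d) (bracket x y)"
  using leibniz[of x y j] assms
  by (simp add: bracket_simps scale_left_distrib algebra_simps)

lemma bracket_sum_left: "bracket (sum f A) z = (\<Sum>x\<in>A. bracket (f x) z)"
  by (induction A rule: infinite_finite_induct) (simp_all add: bracket_simps)

text \<open>The \<open>g p\<close> span a subalgebra that \<open>proj\<close> maps isomorphically
  onto the Diamond algebra.\<close>

lemma split_generators: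
  obtains g where "\<And>p. proj (g p) = axis p 1"
    and "\<And>p q. bracket (g p) (g q) = (\<Sum>r\<in>UNIV. sc (diamond_table p q $ r) (g r))"
proof -
  obtain j where j: "proj j = axis J 1" "bracket j j = 0"
    by (rule exists_lift_J)
  obtain h where h: "\<And>p. proj (h p) = axis p 1"
      "\<And>p. bracket (h p) j = sc (diamond_weight p) (h p)"
    using exists_weight_lift[OF j(1)] by metis
  show thesis
  proof
    show "proj (h p) = axis p 1" for p by (rule h)
    fix p q
    let ?c = "diamond_weight p + diamond_weight q"
    let ?t = "\<Sum>r\<in>UNIV. sc (diamond_table p q $ r) (h r)"
    let ?d = "bracket (h p) (h q) - ?t"
    have "proj ?t = diamond_table p q"
      by (simp add: proj_sum proj_simps h flip: vec_eq_sum_axis)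
    then have "?d \<in> I"
      by (simp add: proj_diff proj_simps h diamond_bracket_axis flip: proj_eq_0_iff)
    \<comment> \<open>Every \<open>r\<close> with a nonzero table coefficient has weight
      \<open>?c\<close>, so \<open>?t\<close>, and with it the defect \<open>?d\<close>, has this
      weight.\<close>
    moreover have "bracket ?t j = sc ?c ?t"
      unfolding bracket_sum_left scale_sum_right
      using diamond_table_weight[of p q]
      by (intro sum.cong refl) (auto simp: bracket_simps h mult.commute)
    then have "bracket ?d j = sc ?c ?d"
      using weight_bracket[OF h(2) h(2)]
      by (simp add: bracket_simps(5) scale_right_diff_distrib)
    ultimately have "?d = 0"
      using module_weight_neq_diamond_weight_add by (intro weight_vector_in_I_eq_0[OF j(1)])
    then show "bracket (h p) (h q) = ?t" by simp
  qed
qed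

section \<open>Assembling the basis and its table\<close>

lemma L2_basis:
  "\<exists>e. indexed_basis e \<and> (\<forall>p q. bracket (e p) (e q) = L2_table sc e p q)"
proof -
  obtain g where g: "\<And>p. proj (g p) = axis p 1"
    and gg: "\<And>p q. bracket (g p) (g q) = (\<Sum>r\<in>UNIV. sc (diamond_table p q $ r) (g r))"
    using split_generators by blast
  have "\<exists>x. x \<in> I \<and> \<Psi> x = axis m 1" for m
    by (metis \<Psi>_surj)
  then obtain X where X: "\<And>m. X m \<in> I" "\<And>m. \<Psi> (X m) = axis m 1"
    by metis
  have scale_X: "sc c (X m) \<in> I" for c m
    using X subspace_I by (simp add: subspace_scale)
  then have sum_X: "(\<Sum>m\<in>UNIV. sc (v m) (X m)) \<in> I" for v
    by (simp add: subspace_sum subspace_I)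
  have \<Psi>_sum_X: "\<Psi> (\<Sum>m\<in>UNIV. sc (v m) (X m)) $ n = v n" for v n
    by (simp add: \<Psi>_sum \<Psi>_simps X scale_X axis_def if_distrib[of "(*) _"] cong: if_cong)
  have proj_sum_g: "proj (\<Sum>p\<in>UNIV. sc (v p) (g p)) $ r = v r" for v r
    by (simp add: proj_sum proj_simps g axis_def if_distrib[of "(*) _"] cong: if_cong)
  have expand_I: "a = (\<Sum>m\<in>UNIV. sc (\<Psi> a $ m) (X m))" if "a \<in> I" for a
    using that sum_X by (intro \<Psi>_inj) (simp_all add: vec_eq_iff \<Psi>_sum_X)
  have Xg: "bracket (X m) (g q) = (\<Sum>n\<in>UNIV. sc (module_table m q $ n) (X n))" for m q
    using expand_I[OF bracket_mem_I[OF X(1)], of m "g q"]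
    by (simp add: \<Psi>_bracket X g module_action_axis)
  define e where "e = case_sum g X"
  have e_simps: "e (Inl p) = g p" "e (Inr m) = X m" for p m
    by (simp_all add: e_def)
  have "indexed_basis e"
  proof (rule indexed_basisI)
    fix u i
    assume "(\<Sum>k\<in>UNIV. sc (u k) (e k)) = 0"
    then have *: "(\<Sum>p\<in>UNIV. sc (u (Inl p)) (g p)) + (\<Sum>m\<in>UNIV. sc (u (Inr m)) (X m)) = 0"
      by (simp add: sum_sum_type e_simps)
    \<comment> \<open>\<open>proj\<close> kills the \<open>X\<close> part and isolates the
      coefficients of the \<open>g p\<close>; once these vanish, \<open>\<Psi>\<close> reads off the
      others.\<close>
    have "proj (\<Sum>m\<in>UNIV. sc (u (Inr m)) (X m)) = 0"
      using sum_X by (simp add: proj_eq_0_iff)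
    with arg_cong[OF *, of proj] have "proj (\<Sum>p\<in>UNIV. sc (u (Inl p)) (g p)) = 0"
      by (simp add: proj_simps proj_0)
    then have Inl: "u (Inl p) = 0" for p
      using proj_sum_g[of "\<lambda>p. u (Inl p)" p] by simp
    with * have "u (Inr m) = 0" for m
      using \<Psi>_sum_X[of "\<lambda>m. u (Inr m)" m] by (simp add: \<Psi>_0)
    with Inl show "u i = 0" by (cases i) simp_all
  next
    fix x
    \<comment> \<open>\<open>?y\<close> has the same projection as \<open>x\<close>, so the
      difference lies in \<open>I\<close> and expands in the \<open>X m\<close>.\<close>
    let ?y = "\<Sum>p\<in>UNIV. sc (proj x $ p) (g p)"
    have "proj (x - ?y) = 0"
      by (simp add: proj_diff vec_eq_iff proj_sum_g)
    then have "x - ?y = (\<Sum>m\<in>UNIV. sc (\<Psi> (x - ?y) $ m) (X m))"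
      by (intro expand_I) (simp add: proj_eq_0_iff)
    then have "x = ?y + (\<Sum>m\<in>UNIV. sc (\<Psi> (x - ?y) $ m) (X m))"
      by (metis add.commute diff_add_cancel)
    then show "\<exists>u. x = (\<Sum>k\<in>UNIV. sc (u k) (e k))"
      by (intro exI[of _ "case_sum (($) (proj x)) (($) (\<Psi> (x - ?y)))"])
        (simp add: sum_sum_type e_simps)
  qed
  moreover have "bracket (e p) (e q) = L2_table sc e p q" for p q
  proof (cases q)
    \<comment> \<open>A right factor in \<open>I\<close> gives 0, matching the default clause of
      \<open>L2_table\<close>.\<close>
    case (Inr n)
    then show ?thesis
      by (cases p; simp add: e_simps bracket_I_right X)
  next
    case q: (Inl s)
    show ?thesis
    proof (cases p)
      case (Inl r)
      with q show ?thesis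
        by (cases r; cases s) (simp_all add: e_simps gg UNIV_diamond_gen axis_def)
    next
      case (Inr m)
      with q show ?thesis
        by (cases m; cases s) (simp_all add: e_simps Xg UNIV_module_gen axis_def)
    qed
  qed
  ultimately show ?thesis by blast
qed

end

theorem theorem2:
  fixes sc :: "complex \<Rightarrow> 'a::ab_group_add \<Rightarrow> 'a"
    and bracket :: "'a \<Rightarrow> 'a \<Rightarrow> 'a"
    and \<Phi> :: "'a set \<Rightarrow> complex ^ diamond_gen"
    and \<Psi> :: "'a \<Rightarrow> complex ^ module_gen"
  assumes "leibniz_algebra sc bracket"
    and "leibniz_algebra.corr_iso sc bracket (*s) diamond_bracket \<Phi>"
    and "leibniz_algebra.squares_ideal_iso sc bracket (*s) module_action \<Phi> \<Psi>"
  shows "\<exists>e :: diamond_gen + module_gen \<Rightarrow> 'a.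
    vector_space.indexed_basis sc e \<and>
    (\<forall>p q. bracket (e p) (e q) = L2_table sc e p q)"
proof -
  interpret leibniz_algebra sc bracket by fact
  interpret diamond_extension sc bracket \<Phi> \<Psi>
    by unfold_locales fact+
  show ?thesis by (rule L2_basis)
qed

end
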